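(* Let $\mathcal{C}$ be a covering of a finite set $U$ with $|U|=m$, such that there are no two distinct elements $u,v\in U$ with $\mathcal{C}(\{u\})=\mathcal{C}(\{v\})$ and $|\mathcal{C}(\{u\})|=1$. Let $n\geq 1$ and let $P_n$ be the lattice of partitions of an $n$-element set. If $P_n\cong L(\mathcal{C})$, then $n\leq 3$. Moreover, if $n=3$, then $m=3$ and $k=1$, where $k:=|\mathcal{E}|$.
   Context: A covering of a finite set $U$ is a collection $\mathcal{C}\subseteq 2^U$ of subsets of $U$ whose union is $U$. For $H\subseteq U$, $\mathcal{C}(H):=\{C\in\mathcal{C} : C\cap H\neq\emptyset\}$. The matroid $M(\mathcal{C})$ is the transversal matroid of $\mathcal{C}$ on the ground set $U$: its independent sets are the partial transversals of $\mathcal{C}$, i.e. the sets $I\subseteq U$ for which there is an injective map $\varphi:I\to\mathcal{C}$ with $e\in\varphi(e)$ for all $e\in I$. $L(\mathcal{C})$ is the lattice of closed sets (flats) of $M(\mathcal{C})$ ordered by inclusion. $P_n$ is ordered by refinement: $\pi\leq\sigma$ if every block of $\pi$ is contained in a block of $\sigma$. For $x\in U$ with $|\mathcal{C}(\{x\})|=2$, $E(\{x\}):=\{y\in U : \mathcal{C}(\{y\})\subseteq\mathcal{C}(\{x\})\}$, and $\mathcal{E}:=\{E(\{x\}) : x\in U,\ |\mathcal{C}(\{x\})|=2\}$. *)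

theory Defs
  imports Main "HOL-Library.Disjoint_Sets"
begin

definition covering :: "'a set \<Rightarrow> 'a set set \<Rightarrow> bool" where
  "covering U \<C> \<longleftrightarrow> \<C> \<subseteq> Pow U \<and> \<Union>\<C> = U"

text \<open>The subfamily written $\mathcal{C}(H)$ on paper.\<close>

definition members_meeting :: "'a set set \<Rightarrow> 'a set \<Rightarrow> 'a set set" where
  "members_meeting \<C> H = {C \<in> \<C>. C \<inter> H \<noteq> {}}"

definition partial_transversal :: "'a set \<Rightarrow> 'a set set \<Rightarrow> 'a set \<Rightarrow> bool" where
  "partial_transversal U \<C> I \<longleftrightarrow>
     I \<subseteq> U \<and> (\<exists>\<phi>. inj_on \<phi> I \<and> \<phi> ` I \<subseteq> \<C> \<and> (\<forall>e\<in>I. e \<in> \<phi> e))"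

text \<open>Rank, closure and flats of a matroid given by its ground set and independence predicate.
  They are meant for a finite ground set, where the maximum defining the rank exists.\<close>

definition matroid_rank :: "('a set \<Rightarrow> bool) \<Rightarrow> 'a set \<Rightarrow> nat" where
  "matroid_rank indep X = Max (card ` {I. I \<subseteq> X \<and> indep I})"

definition matroid_closure :: "'a set \<Rightarrow> ('a set \<Rightarrow> bool) \<Rightarrow> 'a set \<Rightarrow> 'a set" where
  "matroid_closure U indep X = {e \<in> U. matroid_rank indep (insert e X) = matroid_rank indep X}"

definition matroid_flats :: "'a set \<Rightarrow> ('a set \<Rightarrow> bool) \<Rightarrow> 'a set set" where
  "matroid_flats U indep = {F. F \<subseteq> U \<and> matroid_closure U indep F = F}"

text \<open>The elements of $L(\mathcal{C})$, the lattice order being inclusion.\<close>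

definition covering_flats :: "'a set \<Rightarrow> 'a set set \<Rightarrow> 'a set set" where
  "covering_flats U \<C> = matroid_flats U (partial_transversal U \<C>)"

text \<open>A bijection between two lattices is a lattice isomorphism exactly if it preserves and
  reflects the order.\<close>

definition order_isomorphic ::
  "'a set \<Rightarrow> ('a \<Rightarrow> 'a \<Rightarrow> bool) \<Rightarrow> 'b set \<Rightarrow> ('b \<Rightarrow> 'b \<Rightarrow> bool) \<Rightarrow> bool" where
  "order_isomorphic A leA B leB \<longleftrightarrow>
     (\<exists>f. bij_betw f A B \<and> (\<forall>x\<in>A. \<forall>y\<in>A. leA x y \<longleftrightarrow> leB (f x) (f y)))"

text \<open>The set written $E(\{x\})$ on paper, and the family $\mathcal{E}$ of those with
  $|\mathcal{C}(\{x\})| = 2$.\<close>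

definition E_set :: "'a set \<Rightarrow> 'a set set \<Rightarrow> 'a \<Rightarrow> 'a set" where
  "E_set U \<C> x = {y \<in> U. members_meeting \<C> {y} \<subseteq> members_meeting \<C> {x}}"

definition E_family :: "'a set \<Rightarrow> 'a set set \<Rightarrow> 'a set set" where
  "E_family U \<C> = {E_set U \<C> x | x. x \<in> U \<and> card (members_meeting \<C> {x}) = 2}"

end

theory Submission
  imports Defs
begin

text \<open>
  The hypotheses make the transversal matroid simple, so the isomorphism identifies the points of
  \<open>U\<close> with the two-element subsets of \<open>S\<close> and turns triangles \<open>{ij, jk, ik}\<close> into dependent triples.
  By Hall's condition a dependent triple meets exactly two members of the covering, and since no
  two points lie in the same single member, one of its points lies in both of them.
  Say this is the point \<open>ij\<close> of the triangle on \<open>{i, j, k}\<close>. If there is a fourth element \<open>l\<close>, the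
  triangle on \<open>{i, j, l}\<close> meets the same two members, so \<open>{ij, jk, ik, il}\<close> has rank two and
  \<open>{ij, jk, ik}\<close> is not closed; but it is the flat of the partition with the single nontrivial
  block \<open>{i, j, k}\<close>.
\<close>

section \<open>Distinct representatives\<close>

text \<open>If all elements of \<open>A\<close> agree with all elements of \<open>B\<close>, one
  element exhausts both sets. This is Hall's condition for two nonempty sets.\<close>

lemma two_representatives:
  assumes "A \<noteq> {}" "B \<noteq> {}" "\<not> (A = B \<and> card A = 1)"
  obtains a b where "a \<in> A" "b \<in> B" "a \<noteq> b"
proof (rule ccontr)
  assume "\<not> thesis"
  then have eq: "\<And>a b. a \<in> A \<Longrightarrow> b \<in> B \<Longrightarrow> a = b" using that by blast
  obtain x where "x \<in> A" using assms(1) by blast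
  then have "A = {x}" "B = {x}" using eq assms(2) by blast+
  then show False using assms(3) by simp
qed

text \<open>An exchange argument: \<open>B\<close> has two candidates \<open>b\<close> and
  \<open>w\<close>. Distinct \<open>a'\<close> and \<open>d'\<close> from \<open>A\<close> and
  \<open>D\<close> leave one of them free unless \<open>{a', d'} = {b, w}\<close>. In that case
  \<open>A\<close> takes \<open>a'\<close>, \<open>B\<close> takes the other of the two, and
  \<open>D\<close> falls back on \<open>d\<close>, which differs from both.\<close>

lemma three_representatives_aux:
  assumes "a \<in> A" "b \<in> B" "d \<in> D" "b \<noteq> d" "w \<in> B" "w \<noteq> b" "w \<noteq> d"
    and "\<not> (A = D \<and> card A = 1)"
  shows "\<exists>a\<in>A. \<exists>b\<in>B. \<exists>d\<in>D. a \<noteq> b \<and> b \<noteq> d \<and> a \<noteq> d"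
proof -
  have "A \<noteq> {}" "D \<noteq> {}" using assms(1,3) by blast+
  then obtain a' d' where ad: "a' \<in> A" "d' \<in> D" "a' \<noteq> d'"
    using two_representatives[OF _ _ assms(8)] by blast
  then consider "w \<notin> {a', d'}" | "b \<notin> {a', d'}" | "a' = b" "d' = w" | "a' = w" "d' = b"
    using assms(6) by blast
  then show ?thesis
  proof cases
    case 1
    then show ?thesis
      using ad assms(5) by (intro bexI[of _ a'] bexI[of _ w] bexI[of _ d']) auto
  next
    case 2
    then show ?thesis
      using ad assms(2) by (intro bexI[of _ a'] bexI[of _ b] bexI[of _ d']) auto
  next
    case 3
    then show ?thesis
      using ad assms by (intro bexI[of _ b] bexI[of _ w] bexI[of _ d]) auto
  next
    case 4
    then show ?thesis
      using ad assms by (intro bexI[of _ w] bexI[of _ b] bexI[of _ d]) auto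
  qed
qed

text \<open>Hall's condition for three sets. Distinct \<open>b\<close> and \<open>d\<close> exist by
  the case of two sets, and the size of the union supplies a third element \<open>w\<close>. If
  \<open>w\<close> lies in \<open>A\<close>, it completes the choice; otherwise the exchange
  argument applies.\<close>

lemma three_representatives:
  assumes "A \<noteq> {}" "B \<noteq> {}" "D \<noteq> {}"
    and AB: "\<not> (A = B \<and> card A = 1)" and AD: "\<not> (A = D \<and> card A = 1)"
    and BD: "\<not> (B = D \<and> card B = 1)"
    and big: "\<not> card (A \<union> B \<union> D) \<le> 2"
  shows "\<exists>a\<in>A. \<exists>b\<in>B. \<exists>d\<in>D. a \<noteq> b \<and> b \<noteq> d \<and> a \<noteq> d"
proof -
  obtain a where a: "a \<in> A" using assms by blast
  obtain b d where bd: "b \<in> B" "d \<in> D" "b \<noteq> d"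
    using two_representatives[OF assms(2,3) BD] by blast
  have "\<not> A \<union> B \<union> D \<subseteq> {b, d}"
    using big card_mono[of "{b, d}" "A \<union> B \<union> D"] bd by auto
  then obtain w where w: "w \<in> A \<union> B \<union> D" "w \<noteq> b" "w \<noteq> d" by blast
  then consider "w \<in> A" | "w \<in> B" | "w \<in> D" by blast
  then show ?thesis
  proof cases
    case 1
    then show ?thesis
      using w bd by (intro bexI[of _ w] bexI[of _ b] bexI[of _ d]) auto
  next
    case 2
    then show ?thesis
      using three_representatives_aux[OF a bd _ w(2,3) AD] by blast
  next
    case 3
    \<comment> \<open>The exchange argument with the roles of \<open>B\<close> and \<open>D\<close>
      swapped, so that \<open>AB\<close> replaces \<open>AD\<close>.\<close>
    then obtain a' d' b' where "a' \<in> A" "d' \<in> D" "b' \<in> B" "a' \<noteq> d'" "d' \<noteq> b'" "a' \<noteq> b'"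
      using three_representatives_aux[OF a bd(2,1) bd(3)[symmetric] _ w(3,2) AB] by blast
    then show ?thesis by (intro bexI[of _ a'] bexI[of _ b'] bexI[of _ d']) auto
  qed
qed

section \<open>Simple transversal matroids\<close>

lemma matroid_rank_ge_card:
  assumes "finite X" "I \<subseteq> X" "indep I"
  shows "card I \<le> matroid_rank indep X"
  unfolding matroid_rank_def using assms by (intro Max_ge) auto

lemma matroid_rank_le:
  assumes "finite X" "indep {}" "\<And>I. I \<subseteq> X \<Longrightarrow> indep I \<Longrightarrow> card I \<le> r"
  shows "matroid_rank indep X \<le> r"
  unfolding matroid_rank_def using assms by (subst Max_le_iff) auto

lemma matroid_rank_mono:
  assumes "finite Y" "X \<subseteq> Y" "indep {}"
  shows "matroid_rank indep X \<le> matroid_rank indep Y"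
  using assms finite_subset[OF assms(2,1)]
  by (intro matroid_rank_le) (auto intro: matroid_rank_ge_card)

text \<open>Among the sets between \<open>X\<close> and \<open>U\<close> whose rank rises when
  \<open>z\<close> is added, a maximal one \<open>F\<close> is closed. If some \<open>e\<close>
  outside \<open>F\<close> kept the rank, then by maximality \<open>z\<close> would not raise the
  rank of \<open>insert e F\<close>, and monotonicity would bound the rank of
  \<open>insert z F\<close> by that of \<open>F\<close>.\<close>

lemma flat_avoiding_element:
  assumes "finite U" "indep {}" "X \<subseteq> U" "z \<in> U"
    and "matroid_rank indep X < matroid_rank indep (insert z X)"
  shows "\<exists>F\<in>matroid_flats U indep. X \<subseteq> F \<and> z \<notin> F"
proof -
  let ?r = "matroid_rank indep"
  let ?\<F> = "{F. X \<subseteq> F \<and> F \<subseteq> U \<and> ?r F < ?r (insert z F)}"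
  have fin: "finite ?\<F>" and X: "X \<in> ?\<F>" using assms by auto
  obtain F where F: "F \<in> ?\<F>" and "\<forall>G\<in>?\<F>. F \<subseteq> G \<longrightarrow> F = G"
    using finite_has_maximal2[OF fin X] by (elim bexE conjE)
  then have max: "F = G" if "G \<in> ?\<F>" "F \<subseteq> G" for G using that by blast
  have fin: "finite F" using F finite_subset[OF _ assms(1)] by blast
  have "e \<in> F" if e: "e \<in> U" "?r (insert e F) = ?r F" for e
  proof (rule ccontr)
    assume "e \<notin> F"
    then have "insert e F \<notin> ?\<F>" using max[of "insert e F"] by blast
    then have "?r (insert z (insert e F)) \<le> ?r F" using F e by auto
    moreover have "?r (insert z F) \<le> ?r (insert z (insert e F))"
      using fin assms by (intro matroid_rank_mono) auto
    ultimately show False using F by auto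
  qed
  then have "F \<in> matroid_flats U indep"
    using F by (auto simp: matroid_flats_def matroid_closure_def insert_absorb)
  moreover have "z \<notin> F" using F by (auto simp: insert_absorb)
  ultimately show ?thesis using F by blast
qed

section \<open>Members through a point and simplicity of the matroid\<close>

lemma members_meeting_UN: "members_meeting \<C> H = (\<Union>u\<in>H. members_meeting \<C> {u})"
  by (auto simp: members_meeting_def)

lemma mem_members_meeting: "X \<in> members_meeting \<C> {u} \<longleftrightarrow> X \<in> \<C> \<and> u \<in> X"
  by (auto simp: members_meeting_def)

text \<open>These assumptions make the transversal matroid simple: \<open>covers\<close> rules out
  loops, and by Hall's condition two points are parallel only if both lie in the same single member,
  which \<open>simple\<close> forbids.\<close>

locale simple_covering =
  fixes U :: "'a set" and \<C> :: "'a set set"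
  assumes finite_U: "finite U"
    and covers: "covering U \<C>"
    and simple: "\<lbrakk>u \<in> U; v \<in> U; u \<noteq> v; members_meeting \<C> {u} = members_meeting \<C> {v}\<rbrakk>
                  \<Longrightarrow> card (members_meeting \<C> {u}) \<noteq> 1"
begin

abbreviation c :: "'a \<Rightarrow> 'a set set" where "c u \<equiv> members_meeting \<C> {u}"

abbreviation rk :: "'a set \<Rightarrow> nat" where "rk \<equiv> matroid_rank (partial_transversal U \<C>)"

lemma finite_members: "finite (members_meeting \<C> H)"
proof -
  have "finite \<C>" using finite_U covers by (auto simp: covering_def intro: finite_subset)
  then show ?thesis by (simp add: members_meeting_def)
qed

lemma c_nonempty: "u \<in> U \<Longrightarrow> c u \<noteq> {}"
  using covers unfolding covering_def mem_members_meeting set_eq_iff by blast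

lemma partial_transversal_empty: "partial_transversal U \<C> {}"
  by (simp add: partial_transversal_def)

lemma partial_transversalI:
  assumes "I \<subseteq> U" "inj_on \<phi> I" "\<And>e. e \<in> I \<Longrightarrow> \<phi> e \<in> c e"
  shows "partial_transversal U \<C> I"
  using assms unfolding partial_transversal_def mem_members_meeting by blast

lemma partial_transversal_singleton:
  assumes "u \<in> U"
  shows "partial_transversal U \<C> {u}"
proof -
  obtain X where "X \<in> c u" using c_nonempty[OF assms] by blast
  then show ?thesis using assms by (intro partial_transversalI[where \<phi> = "\<lambda>_. X"]) auto
qed

lemma partial_transversal_pair:
  assumes "u \<in> U" "v \<in> U" "u \<noteq> v"
  shows "partial_transversal U \<C> {u, v}"
proof -
  obtain X Y where "X \<in> c u" "Y \<in> c v" "X \<noteq> Y"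
    using two_representatives[of "c u" "c v"] c_nonempty assms simple[OF assms] by metis
  then show ?thesis
    using assms by (intro partial_transversalI[where \<phi> = "\<lambda>w. if w = u then X else Y"]) auto
qed

text \<open>A choice of representatives injects an independent subset of \<open>X\<close> into the
  members meeting \<open>X\<close>. This caps the rank of a triangle, even enlarged by a further
  point, by the number of members met.\<close>

lemma rank_le_card_members:
  assumes "X \<subseteq> U"
  shows "rk X \<le> card (members_meeting \<C> X)"
proof (rule matroid_rank_le)
  show "finite X" using assms finite_U by (rule finite_subset)
  fix I assume "I \<subseteq> X" "partial_transversal U \<C> I"
  then obtain \<phi> where \<phi>: "inj_on \<phi> I" "\<phi> ` I \<subseteq> \<C>" "\<forall>e\<in>I. e \<in> \<phi> e"
    unfolding partial_transversal_def by blast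
  then have "\<phi> ` I \<subseteq> members_meeting \<C> X"
    using \<open>I \<subseteq> X\<close> by (auto simp: members_meeting_def)
  with \<phi>(1) show "card I \<le> card (members_meeting \<C> X)"
    by (rule card_inj_on_le) (rule finite_members)
qed (rule partial_transversal_empty)

lemma rank_ge_card:
  assumes "partial_transversal U \<C> I" "I \<subseteq> X" "X \<subseteq> U"
  shows "card I \<le> rk X"
  using finite_subset[OF assms(3) finite_U] assms(2,1) by (rule matroid_rank_ge_card)

lemma rank_le_card:
  assumes "finite X"
  shows "rk X \<le> card X"
  using assms partial_transversal_empty by (intro matroid_rank_le) (auto intro: card_mono)

section \<open>Flats and collinear triples\<close>

lemma covering_flats_subset: "F \<in> covering_flats U \<C> \<Longrightarrow> F \<subseteq> U"
  by (simp add: covering_flats_def matroid_flats_def)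

lemma covering_flatsI:
  assumes "F \<subseteq> U" "\<And>e. e \<in> U \<Longrightarrow> e \<notin> F \<Longrightarrow> rk (insert e F) \<noteq> rk F"
  shows "F \<in> covering_flats U \<C>"
  using assms by (auto simp: covering_flats_def matroid_flats_def matroid_closure_def insert_absorb)

lemma covering_flatsD:
  assumes "F \<in> covering_flats U \<C>" "e \<in> U" "e \<notin> F"
  shows "rk (insert e F) \<noteq> rk F"
  using assms by (auto simp: covering_flats_def matroid_flats_def matroid_closure_def)

lemma empty_flat: "{} \<in> covering_flats U \<C>"
proof (rule covering_flatsI)
  fix e assume "e \<in> U"
  then show "rk {e} \<noteq> rk {}"
    using rank_ge_card[OF partial_transversal_singleton, of e "{e}"] rank_le_card[of "{}"] by auto
qed simp

text \<open>Every pair of points is independent, so a second point raises the rank. Together with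
  \<open>empty_flat\<close> this identifies the bottom and the atoms of the lattice of
  flats.\<close>

lemma singleton_flat:
  assumes "u \<in> U"
  shows "{u} \<in> covering_flats U \<C>"
proof (rule covering_flatsI)
  fix e assume "e \<in> U" "e \<notin> {u}"
  then show "rk {e, u} \<noteq> rk {u}"
    using assms rank_ge_card[OF partial_transversal_pair, of e u "{e, u}"] rank_le_card[of "{u}"]
    by auto
qed (use assms in simp)

text \<open>If the triple were independent, \<open>z\<close> would raise the rank of
  \<open>{x, y}\<close> and some flat through \<open>x\<close> and \<open>y\<close> would avoid
  \<open>z\<close>, against \<open>line\<close>. A dependent triple violates Hall's condition;
  simplicity excludes a violation by one or two points, so the triple itself meets at most two
  members. It meets at least two because \<open>{x, y}\<close> is independent.\<close>

lemma card_members_collinear: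
  assumes "x \<in> U" "y \<in> U" "z \<in> U" "x \<noteq> y" "x \<noteq> z" "y \<noteq> z"
    and line: "\<And>F. F \<in> covering_flats U \<C> \<Longrightarrow> x \<in> F \<Longrightarrow> y \<in> F \<Longrightarrow> z \<in> F"
  shows "card (members_meeting \<C> {x, y, z}) = 2"
proof (rule antisym)
  have "\<not> partial_transversal U \<C> {x, y, z}"
  proof
    assume "partial_transversal U \<C> {x, y, z}"
    then have "rk {x, y} < rk (insert z {x, y})"
      using rank_ge_card[of "{x, y, z}" "insert z {x, y}"] rank_le_card[of "{x, y}"] assms by auto
    with assms(1-3) have "\<exists>F\<in>covering_flats U \<C>. {x, y} \<subseteq> F \<and> z \<notin> F"
      unfolding covering_flats_def
      by (intro flat_avoiding_element finite_U partial_transversal_empty) auto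
    then show False using line by blast
  qed
  moreover have "partial_transversal U \<C> {x, y, z}"
    if "X \<in> c x" "Y \<in> c y" "Z \<in> c z" "X \<noteq> Y" "Y \<noteq> Z" "X \<noteq> Z" for X Y Z
    using that assms
    by (intro partial_transversalI[where \<phi> = "\<lambda>w. if w = x then X else if w = y then Y else Z"])
      (auto simp: inj_on_def)
  ultimately have "\<not> (\<exists>X\<in>c x. \<exists>Y\<in>c y. \<exists>Z\<in>c z. X \<noteq> Y \<and> Y \<noteq> Z \<and> X \<noteq> Z)"
    by blast
  then have "card (c x \<union> c y \<union> c z) \<le> 2"
    using three_representatives[OF c_nonempty[OF assms(1)] c_nonempty[OF assms(2)]
        c_nonempty[OF assms(3)]] simple[OF assms(1,2,4)] simple[OF assms(1,3,5)]
      simple[OF assms(2,3,6)] by blast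
  then show "card (members_meeting \<C> {x, y, z}) \<le> 2"
    by (simp add: members_meeting_UN[of _ "{x, y, z}"] Un_assoc)
  have "2 \<le> rk {x, y, z}"
    using rank_ge_card[OF partial_transversal_pair, of x y "{x, y, z}"] assms by auto
  then show "2 \<le> card (members_meeting \<C> {x, y, z})"
    using rank_le_card_members[of "{x, y, z}"] assms by auto
qed

text \<open>Pigeonhole: if each of the three points lay in only one of the two members, two points
  would share the same single member, against \<open>simple\<close>.\<close>

lemma exists_full_point:
  assumes "L \<subseteq> U" "card L = 3" "card (members_meeting \<C> L) = 2"
  shows "\<exists>x\<in>L. c x = members_meeting \<C> L"
proof (rule ccontr)
  assume "\<not> ?thesis"
  then have none: "c x \<noteq> members_meeting \<C> L" if "x \<in> L" for x
    using that by blast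
  obtain X Y where XY: "members_meeting \<C> L = {X, Y}"
    using assms(3) unfolding card_2_iff by blast
  have c_cases: "c x = {X} \<or> c x = {Y}" if x: "x \<in> L" for x
  proof -
    have "c x \<subseteq> {X, Y}" using XY x members_meeting_UN[of \<C> L] by auto
    moreover have "c x \<noteq> {}" using c_nonempty x assms(1) by auto
    moreover have "c x \<noteq> {X, Y}" using none[OF x] XY by simp
    ultimately show ?thesis by blast
  qed
  have "inj_on c L"
  proof (rule inj_onI, rule ccontr)
    fix x y assume xy: "x \<in> L" "y \<in> L" "c x = c y" "x \<noteq> y"
    then have "card (c x) \<noteq> 1" using simple[of x y] assms(1) by auto
    then show False using c_cases[OF xy(1)] by auto
  qed
  then have "card L \<le> card {{X}, {Y}}"
    using c_cases by (intro card_inj_on_le[where f = c]) auto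
  also have "\<dots> \<le> 2" by (simp add: card_insert_if)
  finally show False using assms(2) by simp
qed

end

section \<open>Partitions with one nontrivial block\<close>

text \<open>A singleton \<open>B\<close> gives the finest partition of \<open>S\<close>, and the
  two-element \<open>B\<close> give the atoms of the partition lattice. For \<open>B = {}\<close>
  the family contains an empty block and is no partition, hence the condition
  \<open>B \<noteq> {}\<close> in what follows.\<close>

definition block_partition :: "'b set \<Rightarrow> 'b set \<Rightarrow> 'b set set" where
  "block_partition S B = insert B ((\<lambda>x. {x}) ` (S - B))"

lemma partition_on_block_partition:
  assumes "B \<subseteq> S" "B \<noteq> {}"
  shows "partition_on S (block_partition S B)"
  using assms by (intro partition_onI) (auto simp: block_partition_def disjnt_def)

text \<open>The singleton blocks lie in blocks of \<open>P\<close> because \<open>P\<close> covers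
  \<open>S\<close>, so \<open>B\<close> is the only block that imposes a condition.\<close>

lemma block_partition_refines_iff:
  assumes "B \<subseteq> S" "B \<noteq> {}" "partition_on S P"
  shows "refines S (block_partition S B) P \<longleftrightarrow> (\<exists>Y\<in>P. B \<subseteq> Y)"
  using assms partition_on_block_partition[OF assms(1,2)] partition_onD1[OF assms(3)]
  by (auto simp: refines_def block_partition_def)

text \<open>A two-element set fits into no singleton block, so only \<open>B\<close> can contain
  it.\<close>

lemma block_partition_refines_block_partition_iff:
  assumes "e \<subseteq> S" "card e = 2" "B \<subseteq> S" "B \<noteq> {}"
  shows "refines S (block_partition S e) (block_partition S B) \<longleftrightarrow> e \<subseteq> B"
proof -
  have "e \<noteq> {}" "\<not> e \<subseteq> {x}" for x
    using assms(2) card_mono[of "{x}" e] by auto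
  then show ?thesis
    using assms by (subst block_partition_refines_iff)
      (auto simp: partition_on_block_partition, auto simp: block_partition_def)
qed

section \<open>Partition lattices as lattices of flats\<close>

context simple_covering
begin

text \<open>An order isomorphism matches atoms: the partitions with one pair as nontrivial block go
  to the one-point flats, which defines \<open>g\<close>. Comparing atoms with an arbitrary
  partition shows that \<open>g e\<close> lies in its flat exactly if \<open>e\<close> lies in one
  of its blocks. The second clause applies this to \<open>block_partition S B\<close>; the third is
  transitivity of lying in a common block.\<close>

lemma coordinatization:
  assumes iso: "order_isomorphic {P. partition_on S P} (refines S) (covering_flats U \<C>) (\<subseteq>)"
    and "S \<noteq> {}"
  shows "\<exists>g. bij_betw g {e. e \<subseteq> S \<and> card e = 2} U \<and>
    (\<forall>B. B \<subseteq> S \<and> B \<noteq> {} \<longrightarrow> g ` {e. e \<subseteq> B \<and> card e = 2} \<in> covering_flats U \<C>) \<and>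
    (\<forall>F\<in>covering_flats U \<C>. \<forall>i\<in>S. \<forall>j\<in>S. \<forall>k\<in>S. i \<noteq> j \<longrightarrow> i \<noteq> k \<longrightarrow> j \<noteq> k \<longrightarrow>
      g {i, j} \<in> F \<longrightarrow> g {j, k} \<in> F \<longrightarrow> g {i, k} \<in> F)"
proof -
  let ?E = "{e. e \<subseteq> S \<and> card e = 2}"
  let ?\<pi> = "block_partition S"
  obtain f where f: "bij_betw f {P. partition_on S P} (covering_flats U \<C>)"
    and le: "\<And>P Q. partition_on S P \<Longrightarrow> partition_on S Q \<Longrightarrow> refines S P Q \<longleftrightarrow> f P \<subseteq> f Q"
    using iso unfolding order_isomorphic_def by auto
  have flat: "f P \<in> covering_flats U \<C>" if "partition_on S P" for P
    using f that bij_betwE by blast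
  have onto: "\<exists>P. partition_on S P \<and> f P = F" if "F \<in> covering_flats U \<C>" for F
    using f that unfolding bij_betw_def by (metis (mono_tags, lifting) imageE mem_Collect_eq)
  have E_ne: "e \<noteq> {}" if "e \<in> ?E" for e using that by auto
  have part: "partition_on S (?\<pi> e)" if "e \<in> ?E" for e
    using that E_ne[OF that] by (auto intro: partition_on_block_partition)
  \<comment> \<open>A partition sent to the empty flat refines every partition, but
    \<open>?\<pi> e\<close> does not refine the finest one, \<open>?\<pi> {s}\<close>.\<close>
  have f_ne: "f (?\<pi> e) \<noteq> {}" if e: "e \<in> ?E" for e
  proof
    assume "f (?\<pi> e) = {}"
    moreover obtain s where s: "s \<in> S" using \<open>S \<noteq> {}\<close> by blast
    then have "partition_on S (?\<pi> {s})" by (auto intro: partition_on_block_partition)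
    ultimately have "refines S (?\<pi> e) (?\<pi> {s})" using le part[OF e] by simp
    then have "e \<subseteq> {s}" using e s block_partition_refines_block_partition_iff[of e S "{s}"] by auto
    then have "card e \<le> 1" using card_mono[of "{s}" e] by simp
    then show False using e by simp
  qed
  have point: "\<exists>e\<in>?E. f (?\<pi> e) = {u}" if u: "u \<in> U" for u
  proof -
    obtain P where P: "partition_on S P" "f P = {u}"
      using onto[OF singleton_flat[OF u]] by blast
    \<comment> \<open>A \<open>P\<close> with only singleton blocks would refine the partition
      \<open>Q\<close> of the empty flat, giving \<open>{u} \<subseteq> {}\<close>.\<close>
    have "\<exists>Y\<in>P. \<exists>i\<in>Y. \<exists>j\<in>Y. i \<noteq> j"
    proof (rule ccontr)
      assume no: "\<not> ?thesis"
      obtain Q where Q: "partition_on S Q" "f Q = {}" using onto[OF empty_flat] by blast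
      have "\<exists>Z\<in>Q. Y \<subseteq> Z" if Y: "Y \<in> P" for Y
      proof -
        obtain i where i: "i \<in> Y" using Y P(1) by (metis ex_in_conv partition_onD3)
        moreover have "i \<in> \<Union>Q" using Y i P(1) Q(1) by (metis UnionI partition_onD1)
        ultimately obtain Z where "Z \<in> Q" "i \<in> Z" by blast
        moreover have "Y \<subseteq> {i}" using no Y i by blast
        ultimately show ?thesis by blast
      qed
      then have "refines S P Q" using P Q by (simp add: refines_def)
      then show False using le P Q by auto
    qed
    then obtain Y i j where Y: "Y \<in> P" "i \<in> Y" "j \<in> Y" "i \<noteq> j" by blast
    then have e: "{i, j} \<in> ?E" using P(1) partition_onD1 by fastforce
    have "refines S (?\<pi> {i, j}) P"
      using e Y P(1) by (subst block_partition_refines_iff) auto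
    then have "f (?\<pi> {i, j}) \<subseteq> {u}" using le part[OF e] P by auto
    then have "f (?\<pi> {i, j}) = {u}" using f_ne[OF e] by blast
    then show ?thesis using e by blast
  qed
  \<comment> \<open>Conversely, the pair \<open>e'\<close> belonging to a point \<open>u\<close> of
    \<open>f (?\<pi> e)\<close> is contained in \<open>e\<close>, and equal size forces
    \<open>e' = e\<close>.\<close>
  have "\<exists>u. f (?\<pi> e) = {u}" if e: "e \<in> ?E" for e
  proof -
    obtain u where u: "u \<in> f (?\<pi> e)" using f_ne[OF e] by blast
    then have "u \<in> U" using flat[OF part[OF e]] covering_flats_subset by blast
    then obtain e' where e': "e' \<in> ?E" "f (?\<pi> e') = {u}" using point by blast
    then have "refines S (?\<pi> e') (?\<pi> e)" using le part e u by auto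
    then have "e' \<subseteq> e"
      using e e' E_ne[OF e] block_partition_refines_block_partition_iff[of e' S e] by auto
    moreover have "finite e" using e by (intro card_ge_0_finite) auto
    ultimately have "e' = e" using e e' by (intro card_subset_eq) auto
    then show ?thesis using e' by blast
  qed
  then obtain g where g: "\<And>e. e \<in> ?E \<Longrightarrow> f (?\<pi> e) = {g e}" by metis
  have mem: "g e \<in> f P \<longleftrightarrow> (\<exists>Y\<in>P. e \<subseteq> Y)" if "e \<in> ?E" "partition_on S P" for e P
    using that le[OF part[OF that(1)] that(2)] g[OF that(1)] E_ne[OF that(1)]
      block_partition_refines_iff[of e S P] by auto
  have gU: "g e \<in> U" if "e \<in> ?E" for e
    using flat[OF part[OF that]] g[OF that] covering_flats_subset by blast
  have "inj_on g ?E"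
  proof (rule inj_onI)
    fix e e' assume e: "e \<in> ?E" "e' \<in> ?E" "g e = g e'"
    then have "refines S (?\<pi> e) (?\<pi> e')" "refines S (?\<pi> e') (?\<pi> e)"
      using le part g by auto
    then show "e = e'"
      using e block_partition_refines_block_partition_iff[of e S e']
        block_partition_refines_block_partition_iff[of e' S e] E_ne by auto
  qed
  moreover have onto_U: "\<exists>e\<in>?E. g e = u" if "u \<in> U" for u
    using point[OF that] g by auto
  ultimately have bij: "bij_betw g ?E U"
    using gU by (auto simp: bij_betw_def)
  have block: "g ` {e. e \<subseteq> B \<and> card e = 2} \<in> covering_flats U \<C>" if B: "B \<subseteq> S" "B \<noteq> {}" for B
  proof -
    have p: "partition_on S (?\<pi> B)" using B by (rule partition_on_block_partition)
    have iff: "g e \<in> f (?\<pi> B) \<longleftrightarrow> e \<subseteq> B" if "e \<in> ?E" for e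
      using le[OF part[OF that] p] g[OF that] that B
        block_partition_refines_block_partition_iff[of e S B] by auto
    have "f (?\<pi> B) = g ` {e. e \<subseteq> B \<and> card e = 2}"
    proof (intro equalityI subsetI)
      fix u assume u: "u \<in> f (?\<pi> B)"
      then have "u \<in> U" using covering_flats_subset[OF flat[OF p]] by blast
      then obtain e where "e \<in> ?E" "g e = u" using onto_U by blast
      then show "u \<in> g ` {e. e \<subseteq> B \<and> card e = 2}" using u iff by blast
    next
      fix u assume "u \<in> g ` {e. e \<subseteq> B \<and> card e = 2}"
      then obtain e where "e \<subseteq> B" "card e = 2" "u = g e" by blast
      then show "u \<in> f (?\<pi> B)" using iff[of e] B by auto
    qed
    then show ?thesis using flat[OF p] by simp
  qed
  have line: "g {i, k} \<in> F"
    if F: "F \<in> covering_flats U \<C>" and ijk: "i \<in> S" "j \<in> S" "k \<in> S" "i \<noteq> j" "i \<noteq> k" "j \<noteq> k"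
      and "g {i, j} \<in> F" "g {j, k} \<in> F" for F i j k
  proof -
    obtain P where P: "partition_on S P" "f P = F" using onto[OF F] by blast
    have "\<exists>Y\<in>P. {i, j} \<subseteq> Y" "\<exists>Y\<in>P. {j, k} \<subseteq> Y"
      using mem[OF _ P(1), of "{i, j}"] mem[OF _ P(1), of "{j, k}"] that P by auto
    then obtain Y Y' where "Y \<in> P" "{i, j} \<subseteq> Y" "Y' \<in> P" "{j, k} \<subseteq> Y'" by blast
    \<comment> \<open>Both blocks contain \<open>j\<close>, and distinct blocks are
      disjoint.\<close>
    moreover from this have "Y = Y'" using P(1) by (auto dest: partition_onD2 disjointD)
    ultimately have "\<exists>Y\<in>P. {i, k} \<subseteq> Y" by blast
    then show ?thesis using mem[OF _ P(1), of "{i, k}"] ijk P by auto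
  qed
  show ?thesis
    by (intro exI[of _ g] conjI bij allI ballI impI) (use block in blast, rule line)
qed

end

section \<open>Triangles and the bound on the number of elements\<close>

lemma two_subsets_of_triple:
  assumes "i \<noteq> j" "i \<noteq> k" "j \<noteq> k"
  shows "{e. e \<subseteq> {i, j, k} \<and> card e = 2} = {{i, j}, {j, k}, {i, k}}"
  using assms by (auto simp: card_2_iff doubleton_eq_iff)

theorem theorem4p10:
  fixes U :: "'a set" and \<C> :: "'a set set" and S :: "'b set" and m n k :: nat
  assumes "finite U" and "card U = m"
    and "covering U \<C>"
    and "\<not> (\<exists>u\<in>U. \<exists>v\<in>U. u \<noteq> v \<and> members_meeting \<C> {u} = members_meeting \<C> {v}
                 \<and> card (members_meeting \<C> {u}) = 1)"
    and "k = card (E_family U \<C>)"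
    and "n \<ge> 1" and "finite S" and "card S = n"
    and "order_isomorphic {P. partition_on S P} (refines S) (covering_flats U \<C>) (\<subseteq>)"
  shows "n \<le> 3 \<and> (n = 3 \<longrightarrow> m = 3 \<and> k = 1)"
proof -
  interpret simple_covering U \<C>
    using assms by unfold_locales blast+
  let ?E = "\<lambda>B. {e. e \<subseteq> B \<and> card e = 2}"
  have "S \<noteq> {}" using assms by auto
  from coordinatization[OF assms(9) this] obtain g where bij: "bij_betw g (?E S) U"
    and block: "\<forall>B. B \<subseteq> S \<and> B \<noteq> {} \<longrightarrow> g ` ?E B \<in> covering_flats U \<C>"
    and line: "\<forall>F\<in>covering_flats U \<C>. \<forall>i\<in>S. \<forall>j\<in>S. \<forall>k\<in>S. i \<noteq> j \<longrightarrow> i \<noteq> k \<longrightarrow> j \<noteq> k \<longrightarrow>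
      g {i, j} \<in> F \<longrightarrow> g {j, k} \<in> F \<longrightarrow> g {i, k} \<in> F"
    by (elim exE conjE)
  have inj: "inj_on g (?E S)" using bij by (rule bij_betw_imp_inj_on)
  have gU: "g e \<in> U" if "e \<in> ?E S" for e using bij that by (rule bij_betw_apply)
  \<comment> \<open>The pairs inside \<open>B\<close> give three distinct points, and by
    \<open>line\<close> every flat through two of them contains the third, so
    \<open>card_members_collinear\<close> applies.\<close>
  have triangle: "g ` ?E B \<subseteq> U" "card (g ` ?E B) = 3" "card (members_meeting \<C> (g ` ?E B)) = 2"
    if B: "B \<subseteq> S" "card B = 3" for B
  proof -
    have "finite B" using B by (intro card_ge_0_finite) simp
    obtain i j l where ijl: "B = {i, j, l}" "i \<noteq> j" "i \<noteq> l" "j \<noteq> l"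
      using B(2) unfolding card_3_iff by blast
    have sub: "?E B \<subseteq> ?E S" using B by auto
    then show "g ` ?E B \<subseteq> U" using gU by blast
    show "card (g ` ?E B) = 3"
      using card_image[OF inj_on_subset[OF inj sub]] n_subsets[OF \<open>finite B\<close>, of 2] B
      by (simp add: choose_two)
    have eq: "g ` ?E B = {g {i, j}, g {j, l}, g {i, l}}"
      using two_subsets_of_triple[OF ijl(2-4)] ijl(1) by simp
    have S: "i \<in> S" "j \<in> S" "l \<in> S" and E: "{i, j} \<in> ?E S" "{j, l} \<in> ?E S" "{i, l} \<in> ?E S"
      using ijl B(1) by auto
    have "card (members_meeting \<C> {g {i, j}, g {j, l}, g {i, l}}) = 2"
    proof (rule card_members_collinear)
      show "g {i, j} \<noteq> g {j, l}" "g {i, j} \<noteq> g {i, l}" "g {j, l} \<noteq> g {i, l}"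
        using inj_on_eq_iff[OF inj E(1,2)] inj_on_eq_iff[OF inj E(1,3)]
          inj_on_eq_iff[OF inj E(2,3)] ijl(2-4) by (simp_all add: doubleton_eq_iff)
      show "g {i, l} \<in> F" if "F \<in> covering_flats U \<C>" "g {i, j} \<in> F" "g {j, l} \<in> F" for F
        using line[rule_format, OF that(1) S ijl(2-4) that(2,3)] .
    qed (use gU E in blast)+
    then show "card (members_meeting \<C> (g ` ?E B)) = 2" using eq by simp
  qed
  have "n \<le> 3"
  proof (rule ccontr)
    assume "\<not> n \<le> 3"
    then obtain B where B: "B \<subseteq> S" "card B = 3"
      using assms(8) by (metis nat_le_linear obtain_subset_with_card_n)
    have "B \<noteq> S" using B assms(8) \<open>\<not> n \<le> 3\<close> by auto
    then obtain l where l: "l \<in> S" "l \<notin> B" using B by blast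
    let ?T = "g ` ?E B"
    obtain x where "x \<in> ?T" "c x = members_meeting \<C> ?T"
      using exists_full_point[OF triangle[OF B]] by auto
    then obtain e where e: "e \<subseteq> B" "card e = 2" and ce: "c (g e) = members_meeting \<C> ?T"
      by blast
    obtain i j where ij: "e = {i, j}" "i \<noteq> j" using e(2) unfolding card_2_iff by blast
    \<comment> \<open>A second triangle, sharing with the first the point \<open>g e\<close> that
      lies in both members.\<close>
    have B': "insert l e \<subseteq> S" "card (insert l e) = 3" using e l B(1) ij by (auto simp: card_insert_if)
    let ?T' = "g ` ?E (insert l e)"
    have "c (g e) \<subseteq> members_meeting \<C> ?T'"
      using e members_meeting_UN[of \<C> ?T'] by blast
    \<comment> \<open>The two members through \<open>g e\<close> are among the two members met by
      \<open>?T'\<close>, so they are all of them.\<close>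
    then have eq: "members_meeting \<C> ?T' = members_meeting \<C> ?T"
      using ce triangle(3)[OF B] triangle(3)[OF B'] finite_members by (metis card_subset_eq)
    let ?p = "g {i, l}"
    have il: "{i, l} \<in> ?E (insert l e)" using ij e l by auto
    then have ilS: "{i, l} \<in> ?E S" using B' by blast
    have pT: "?p \<notin> ?T"
    proof
      assume "?p \<in> ?T"
      then obtain e' where "e' \<subseteq> B" "card e' = 2" "g e' = ?p" by auto
      then have "e' = {i, l}" using inj_onD[OF inj, of e' "{i, l}"] ilS B by auto
      then show False using \<open>e' \<subseteq> B\<close> l by blast
    qed
    have "c ?p \<subseteq> members_meeting \<C> ?T'" using il members_meeting_UN[of \<C> ?T'] by blast
    then have "members_meeting \<C> (insert ?p ?T) = members_meeting \<C> ?T"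
      using eq members_meeting_UN[of \<C> "insert ?p ?T"] members_meeting_UN[of \<C> ?T] by auto
    \<comment> \<open>Adding \<open>?p\<close> meets no new member, so the count of members still
      bounds the rank by two.\<close>
    then have up: "rk (insert ?p ?T) \<le> 2"
      using rank_le_card_members[of "insert ?p ?T"] triangle[OF B] gU[OF ilS] by auto
    obtain x y z where T: "?T = {x, y, z}" and "x \<noteq> y"
      using triangle(2)[OF B, unfolded card_3_iff] by (elim exE conjE)
    have "x \<in> U" "y \<in> U" using triangle(1)[OF B] unfolding T by simp_all
    with \<open>x \<noteq> y\<close> have "2 \<le> rk ?T"
      using rank_ge_card[OF partial_transversal_pair, of x y ?T] triangle(1)[OF B]
      unfolding T by simp
    moreover have "rk ?T \<le> rk (insert ?p ?T)"
      using finite_subset[OF triangle(1)[OF B] finite_U] partial_transversal_empty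
      by (intro matroid_rank_mono) auto
    \<comment> \<open>\<open>?T\<close> is closed by \<open>block\<close> and misses
      \<open>?p\<close>, so the rank must change; yet both ranks are squeezed between two and
      two.\<close>
    moreover have "rk (insert ?p ?T) \<noteq> rk ?T"
      using B pT gU[OF ilS] by (intro covering_flatsD block[rule_format]) auto
    ultimately show False using up by linarith
  qed
  moreover have "m = 3 \<and> k = 1" if "n = 3"
  proof -
    \<comment> \<open>With three elements in \<open>S\<close>, the whole ground set is a single
      triangle.\<close>
    have gS: "g ` ?E S = U" using bij by (simp add: bij_betw_def)
    have T: "card U = 3" "card (members_meeting \<C> U) = 2"
      using triangle[of S] that assms gS by auto
    obtain x where x: "x \<in> U" "c x = members_meeting \<C> U"
      using exists_full_point[OF subset_refl T] by blast
    \<comment> \<open>Only two members meet \<open>U\<close>, so a point in two members lies in all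
      of them, and every point satisfies the inclusion defining \<open>E_set\<close>. The full point
      \<open>x\<close> then shows that \<open>E_family\<close> is not empty.\<close>
    have "E_set U \<C> y = U" if "y \<in> U" "card (c y) = 2" for y
    proof -
      have "c y \<subseteq> members_meeting \<C> U" using that members_meeting_UN[of \<C> U] by blast
      then have "c y = members_meeting \<C> U" using that T finite_members by (intro card_subset_eq) auto
      then show ?thesis using members_meeting_UN[of \<C> U] by (auto simp: E_set_def)
    qed
    then have "E_family U \<C> = {U}" using x T(2) unfolding E_family_def by auto metis
    then show ?thesis using T assms by simp
  qed
  ultimately show ?thesis by blast
qed

end
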